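(* Let $(\mathbb{X},d)$ be a quasi-metric space and let $\emptyset\neq\mathscr{C}\subseteq\mathbb{X}$ be bounded. Put $t^{\ast}:=\big(\overline{\dim}_{\mathrm{M},\exp}(\mathscr{C})\big)^{-1}$. Then: (i) There exists a codec sequence $\mathscr{S}^{\ast}=((E_n^{\ast},D_n^{\ast}))_{n\in\mathbb{N}}$ for $\mathscr{C}$ such that for every $0\le t<t^{\ast}$ there exists $C(t)>0$ with $$\delta(E_n^{\ast},D_n^{\ast})\le C(t)\cdot n^{-t}\quad\text{for all } n\in\mathbb{N}.$$ In particular, $\mathcal{R}^t(\mathscr{S}^{\ast},\mathscr{C},\mathbb{X})=\mathscr{C}$ for every such $t$. Assume now that $\mu$ is a probability measure on $\mathbb{X}$ that is critical for $\mathscr{C}$, and set $t^{\sharp}:=\big(\underline{\dim}_{\mathrm{M},\exp}(\mathscr{C})\big)^{-1}$. Then: (ii) For every $t\in(t^{\sharp},\infty)$ there exist $c=c(t)>0$ and $\varepsilon_0=\varepsilon_0(t)>0$ such that for every $n\in\mathbb{N}$ and every $n$-bit codec $(E_n,D_n)$ for $\mathscr{C}$, $$\mu^{\ast}\Big(\big\{x\in\mathscr{C}: d\big(x,D_n(E_n(x))\big)\le\varepsilon\big\}\Big)\le 2^{\,n-c\,\varepsilon^{-1/t}}\quad\text{for all }\varepsilon\in(0,\varepsilon_0).$$ (iii) For every codec sequence $\mathscr{S}=((E_n,D_n))_{n\in\mathbb{N}}$ for $\mathscr{C}$ and every $t\in(t^{\sharp},\infty)$ we have $\mu^{\ast}\big(\mathcal{R}^t(\mathscr{S},\mathscr{C},\mathbb{X})\big)=0$.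 In fact, even $$\mu^{\ast}\Big(\bigcup_{t\in(t^{\sharp},\infty)}\mathcal{R}^t(\mathscr{S},\mathscr{C},\mathbb{X})\Big)=0.$$
   Context: Quasi-metric. $d:\mathbb{X}\times\mathbb{X}\to[0,\infty)$ satisfies the metric axioms with the triangle inequality replaced by $d(x,z)\le k(d(x,y)+d(y,z))$ for some constant $k\ge1$. Write $B(x,r)=\{y\in\mathbb{X}:d(x,y)\le r\}$. For a measure $\mu$ on a $\sigma$-algebra $\mathcal{A}$ on $\mathbb{X}$ and arbitrary $M\subseteq\mathbb{X}$, $\mu^{\ast}(M):=\inf\{\mu(A):A\in\mathcal{A},A\supseteq M\}$. Minkowski dimensions. The covering number $\mathcal{N}(\mathscr{C},\varepsilon)$ is the least $n\in\mathbb{N}$ such that $\mathscr{C}$ is covered by $n$ closed balls of radius $\varepsilon$ with centers in $\mathscr{C}$ ($\infty$ if there is none). If $\mathscr{C}$ is totally bounded with at least two elements, $\underline{\dim}_{\mathrm{M},\exp}(\mathscr{C})$ and $\overline{\dim}_{\mathrm{M},\exp}(\mathscr{C})$ are the $\liminf$ and $\limsup$ as $\varepsilon\downarrow0$ of $\frac{\log_2\log_2\mathcal{N}(\mathscr{C},\varepsilon)}{\log_2(1/\varepsilon)}$. Both are $0$ if $\mathscr{C}$ has fewer than two elements and $\infty$ if $\mathscr{C}$ is not totally bounded. Conventions: $0^{-1}=\infty$, $\infty^{-1}=0$. Criticality. A measure $\mu$ on some $\sigma$-algebra on $\mathbb{X}$ satisfies the small-ball condition with parameter $s\ge 0$ if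 there are $c,r_0>0$ with $\mu^{\ast}(B(x,r))\le\exp(-c(1/r)^s)$ for all $x\in\mathbb{X}$, $0<r<r_0$. It is critical for $\mathscr{C}$ if $\mu^{\ast}(\mathscr{C})>0$ and it satisfies the small-ball condition with parameter $s$ for every $0<s<\underline{\dim}_{\mathrm{M},\exp}(\mathscr{C})$. Codecs. An $n$-bit codec for $\mathscr{C}$ is a pair $(E_n,D_n)$ of arbitrary maps $E_n:\mathscr{C}\to\{0,1\}^n$, $D_n:\{0,1\}^n\to\mathbb{X}$. Its distortion is $\delta(E_n,D_n):=\sup_{x\in\mathscr{C}}d(x,D_n(E_n(x)))$. A codec sequence for $\mathscr{C}$ is a sequence $((E_n,D_n))_{n\in\mathbb{N}}$ where each $(E_n,D_n)$ is an $n$-bit codec for $\mathscr{C}$. For a codec sequence $\mathscr{S}=((E_n,D_n))_{n\in\mathbb{N}}$ and $t\ge0$, $$\mathcal{R}^t(\mathscr{S},\mathscr{C},\mathbb{X}):=\Big\{x\in\mathscr{C}:\ \sup_{n\in\mathbb{N}}\big(n^t\cdot d(x,D_n(E_n(x)))\big)<\infty\Big\}.$$ *)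

theory Defs
  imports "HOL-Probability.Probability"
begin

definition quasi_metric_on :: "'a set \<Rightarrow> ('a \<Rightarrow> 'a \<Rightarrow> real) \<Rightarrow> bool" where
  "quasi_metric_on X d \<longleftrightarrow>
     (\<forall>x\<in>X. \<forall>y\<in>X. 0 \<le> d x y) \<and>
     (\<forall>x\<in>X. \<forall>y\<in>X. d x y = 0 \<longleftrightarrow> x = y) \<and>
     (\<forall>x\<in>X. \<forall>y\<in>X. d x y = d y x) \<and>
     (\<exists>k\<ge>1. \<forall>x\<in>X. \<forall>y\<in>X. \<forall>z\<in>X. d x z \<le> k * (d x y + d y z))"

definition qcball :: "'a set \<Rightarrow> ('a \<Rightarrow> 'a \<Rightarrow> real) \<Rightarrow> 'a \<Rightarrow> real \<Rightarrow> 'a set" where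
  "qcball X d x r = {y\<in>X. d x y \<le> r}"

definition qbounded :: "('a \<Rightarrow> 'a \<Rightarrow> real) \<Rightarrow> 'a set \<Rightarrow> bool" where
  "qbounded d C \<longleftrightarrow> (\<exists>b. \<forall>x\<in>C. \<forall>y\<in>C. d x y \<le> b)"

definition qtotally_bounded :: "'a set \<Rightarrow> ('a \<Rightarrow> 'a \<Rightarrow> real) \<Rightarrow> 'a set \<Rightarrow> bool" where
  "qtotally_bounded X d C \<longleftrightarrow>
     (\<forall>\<epsilon>>0. \<exists>P. finite P \<and> P \<subseteq> C \<and> C \<subseteq> (\<Union>x\<in>P. qcball X d x \<epsilon>))"

text \<open>The infimum of the empty set in \<^typ>\<open>enat\<close> is \<open>\<infinity>\<close>.\<close>

definition covering_number :: "'a set \<Rightarrow> ('a \<Rightarrow> 'a \<Rightarrow> real) \<Rightarrow> 'a set \<Rightarrow> real \<Rightarrow> enat" where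
  "covering_number X d C \<epsilon> =
     Inf {enat n | n. \<exists>P. finite P \<and> card P = n \<and> P \<subseteq> C \<and> C \<subseteq> (\<Union>x\<in>P. qcball X d x \<epsilon>)}"

text \<open>
  For a totally bounded set with at least two elements the covering number is finite, and it is
  at least 2 for all small \<open>\<epsilon>\<close>, so neither the value of \<^const>\<open>the_enat\<close> at \<open>\<infinity>\<close> nor
  that of the logarithm at 0 affects the limits.
\<close>

definition log_log_ratio :: "'a set \<Rightarrow> ('a \<Rightarrow> 'a \<Rightarrow> real) \<Rightarrow> 'a set \<Rightarrow> real \<Rightarrow> ereal" where
  "log_log_ratio X d C \<epsilon> =
     ereal (log 2 (log 2 (real (the_enat (covering_number X d C \<epsilon>)))) / log 2 (1 / \<epsilon>))"

definition lower_dim_exp :: "'a set \<Rightarrow> ('a \<Rightarrow> 'a \<Rightarrow> real) \<Rightarrow> 'a set \<Rightarrow> ereal" where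
  "lower_dim_exp X d C =
     (if \<not> (\<exists>x\<in>C. \<exists>y\<in>C. x \<noteq> y) then 0
      else if \<not> qtotally_bounded X d C then \<infinity>
      else Liminf (at_right 0) (log_log_ratio X d C))"

definition upper_dim_exp :: "'a set \<Rightarrow> ('a \<Rightarrow> 'a \<Rightarrow> real) \<Rightarrow> 'a set \<Rightarrow> ereal" where
  "upper_dim_exp X d C =
     (if \<not> (\<exists>x\<in>C. \<exists>y\<in>C. x \<noteq> y) then 0
      else if \<not> qtotally_bounded X d C then \<infinity>
      else Limsup (at_right 0) (log_log_ratio X d C))"

definition small_ball :: "'a set \<Rightarrow> ('a \<Rightarrow> 'a \<Rightarrow> real) \<Rightarrow> 'a measure \<Rightarrow> real \<Rightarrow> bool" where
  "small_ball X d \<mu> s \<longleftrightarrow>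
     (\<exists>c>0. \<exists>r0>0. \<forall>x\<in>X. \<forall>r. 0 < r \<and> r < r0 \<longrightarrow>
        outer_measure_of \<mu> (qcball X d x r) \<le> ennreal (exp (- c * (1 / r) powr s)))"

definition critical_measure :: "'a set \<Rightarrow> ('a \<Rightarrow> 'a \<Rightarrow> real) \<Rightarrow> 'a set \<Rightarrow> 'a measure \<Rightarrow> bool" where
  "critical_measure X d C \<mu> \<longleftrightarrow>
     outer_measure_of \<mu> C > 0 \<and>
     (\<forall>s>0. ereal s < lower_dim_exp X d C \<longrightarrow> small_ball X d \<mu> s)"

text \<open>
  Bit strings are Boolean lists. An encoder is only constrained on \<open>C\<close> and a decoder only on the
  bit strings of length \<open>n\<close>.
\<close>

type_synonym 'a codec = "('a \<Rightarrow> bool list) \<times> (bool list \<Rightarrow> 'a)"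

definition codec_for :: "'a set \<Rightarrow> 'a set \<Rightarrow> nat \<Rightarrow> 'a codec \<Rightarrow> bool" where
  "codec_for X C n ED \<longleftrightarrow>
     fst ED \<in> C \<rightarrow> {b. length b = n} \<and> snd ED \<in> {b. length b = n} \<rightarrow> X"

definition reconstruct :: "'a codec \<Rightarrow> 'a \<Rightarrow> 'a" where
  "reconstruct ED x = snd ED (fst ED x)"

definition distortion :: "('a \<Rightarrow> 'a \<Rightarrow> real) \<Rightarrow> 'a set \<Rightarrow> 'a codec \<Rightarrow> ereal" where
  "distortion d C ED = (SUP x\<in>C. ereal (d x (reconstruct ED x)))"

text \<open>Sequences are indexed by the positive integers; the value at 0 is irrelevant.\<close>

definition codec_seq_for :: "'a set \<Rightarrow> 'a set \<Rightarrow> (nat \<Rightarrow> 'a codec) \<Rightarrow> bool" where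
  "codec_seq_for X C S \<longleftrightarrow> (\<forall>n\<ge>1. codec_for X C n (S n))"

definition rate_class ::
  "('a \<Rightarrow> 'a \<Rightarrow> real) \<Rightarrow> 'a set \<Rightarrow> (nat \<Rightarrow> 'a codec) \<Rightarrow> real \<Rightarrow> 'a set" where
  "rate_class d C S t =
     {x\<in>C. (SUP n\<in>{1..}. ereal (real n powr t * d x (reconstruct (S n) x))) < \<infinity>}"

end

theory Submission
  imports Defs "HOL-Real_Asymp.Real_Asymp"
begin

text \<open>
  Achievability: with \<open>n\<close> bits one can address the centres of a cover of \<open>C\<close> by \<open>2^n\<close> balls, and
  for \<open>1/t\<close> above the upper dimension such a cover exists at radius \<open>n^(-t)\<close>. A single codec
  sequence serves all \<open>t\<close> because the radii are chosen almost optimally, up to an additive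
  \<open>n^(-n)\<close>.

  Converse: the points reproduced by an \<open>n\<close>-bit codec up to \<open>\<epsilon>\<close> lie in \<open>2^n\<close> balls of radius
  \<open>\<epsilon>\<close>, each of measure at most \<open>exp (-c \<epsilon>^(-1/t))\<close>. For \<open>t\<close> above some \<open>u\<close> with this property,
  the set where the error is at most \<open>K n^(-t)\<close> for all \<open>n\<close> thus has measure at most
  \<open>2^(n - c' n^(t/u))\<close> for every \<open>n\<close>, which tends to zero.
\<close>

section \<open>Outer measures\<close>

text \<open>Balls need not be measurable. Inside the space each set has a measurable hull attaining
  its outer measure, and the measure itself is subadditive on the hulls.\<close>

lemma outer_measure_of_UN_le:
  assumes "finite I" and "\<And>i. i \<in> I \<Longrightarrow> A i \<subseteq> space M"
  shows "outer_measure_of M (\<Union>i\<in>I. A i) \<le> (\<Sum>i\<in>I. outer_measure_of M (A i))"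
proof -
  have "\<forall>i\<in>I. \<exists>E\<in>sets M. A i \<subseteq> E \<and> outer_measure_of M (A i) = emeasure M E"
    by (intro ballI outer_measure_of_attain assms(2))
  then obtain E where E: "\<And>i. i \<in> I \<Longrightarrow> E i \<in> sets M" "\<And>i. i \<in> I \<Longrightarrow> A i \<subseteq> E i"
    "\<And>i. i \<in> I \<Longrightarrow> outer_measure_of M (A i) = emeasure M (E i)"
    by metis
  have "outer_measure_of M (\<Union>i\<in>I. A i) \<le> outer_measure_of M (\<Union>i\<in>I. E i)"
    by (intro outer_measure_of_mono) (use E(2) in blast)
  also have "\<dots> = emeasure M (\<Union>i\<in>I. E i)"
    using assms(1) E(1) by (intro outer_measure_of_eq sets.finite_UN) auto
  also have "\<dots> \<le> (\<Sum>i\<in>I. emeasure M (E i))"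
    using assms(1) E(1) by (intro emeasure_subadditive_finite) auto
  finally show ?thesis using E(3) by simp
qed

lemma outer_measure_of_eq_0_iff:
  assumes "A \<subseteq> space M"
  shows "outer_measure_of M A = 0 \<longleftrightarrow> (\<exists>N\<in>null_sets M. A \<subseteq> N)"
proof
  assume "outer_measure_of M A = 0"
  then show "\<exists>N\<in>null_sets M. A \<subseteq> N"
    using outer_measure_of_attain[OF assms] by (auto simp: null_sets_def)
next
  assume "\<exists>N\<in>null_sets M. A \<subseteq> N"
  then obtain N where "N \<in> null_sets M" "A \<subseteq> N" by blast
  then show "outer_measure_of M A = 0"
    using outer_measure_of_mono[of A N M] by (simp add: null_sets_def)
qed

text \<open>Outer measure zero means being contained in a measurable null set, and null sets are
  closed under countable unions.\<close>

lemma outer_measure_of_UN_eq_0: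
  assumes "countable I" and "\<And>i. i \<in> I \<Longrightarrow> A i \<subseteq> space M"
    and "\<And>i. i \<in> I \<Longrightarrow> outer_measure_of M (A i) = 0"
  shows "outer_measure_of M (\<Union>i\<in>I. A i) = 0"
proof -
  have "\<forall>i\<in>I. \<exists>N\<in>null_sets M. A i \<subseteq> N"
    using assms(2,3) outer_measure_of_eq_0_iff by metis
  then obtain N where N: "\<And>i. i \<in> I \<Longrightarrow> N i \<in> null_sets M" "\<And>i. i \<in> I \<Longrightarrow> A i \<subseteq> N i"
    by metis
  have "(\<Union>i\<in>I. N i) \<in> null_sets M"
    using assms(1) N(1) by (intro null_sets_UN')
  moreover have "(\<Union>i\<in>I. A i) \<subseteq> (\<Union>i\<in>I. N i)"
    using N(2) by blast
  moreover have "(\<Union>i\<in>I. A i) \<subseteq> space M"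
    using assms(2) by blast
  ultimately show ?thesis
    using outer_measure_of_eq_0_iff by metis
qed

section \<open>Covering numbers\<close>

lemma quasi_metric_onD:
  assumes "quasi_metric_on X d"
  shows quasi_metric_on_nonneg: "x \<in> X \<Longrightarrow> y \<in> X \<Longrightarrow> 0 \<le> d x y"
    and quasi_metric_on_zero_iff: "x \<in> X \<Longrightarrow> y \<in> X \<Longrightarrow> d x y = 0 \<longleftrightarrow> x = y"
    and quasi_metric_on_commute: "x \<in> X \<Longrightarrow> y \<in> X \<Longrightarrow> d x y = d y x"
  using assms by (simp_all add: quasi_metric_on_def)

lemma quasi_metric_on_triangle:
  assumes "quasi_metric_on X d"
  obtains k where "k \<ge> 1"
    "\<And>x y z. x \<in> X \<Longrightarrow> y \<in> X \<Longrightarrow> z \<in> X \<Longrightarrow> d x z \<le> k * (d x y + d y z)"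
proof -
  have "\<exists>k\<ge>1. \<forall>x\<in>X. \<forall>y\<in>X. \<forall>z\<in>X. d x z \<le> k * (d x y + d y z)"
    using assms by (simp only: quasi_metric_on_def)
  then obtain k where k: "k \<ge> 1" "\<forall>x\<in>X. \<forall>y\<in>X. \<forall>z\<in>X. d x z \<le> k * (d x y + d y z)"
    by (elim exE conjE)
  show ?thesis
    by (rule that[OF k(1)]) (simp add: k(2))
qed

text \<open>Replaces the infimum by an actual cover: \<open>enat\<close> is well-ordered, so a
  nonempty set of candidates attains its infimum. Asking for \<open>card P \<le> n\<close> rather
  than equality makes the right-hand side monotone in \<open>n\<close>.\<close>

lemma covering_number_le_iff:
  "covering_number X d C r \<le> enat n \<longleftrightarrow>
     (\<exists>P. finite P \<and> card P \<le> n \<and> P \<subseteq> C \<and> C \<subseteq> (\<Union>x\<in>P. qcball X d x r))"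
proof
  define A where "A = {enat n | n. \<exists>P. finite P \<and> card P = n \<and> P \<subseteq> C \<and>
    C \<subseteq> (\<Union>x\<in>P. qcball X d x r)}"
  assume le: "covering_number X d C r \<le> enat n"
  \<comment> \<open>The empty set has infimum \<infinity>, which is not below
    \<open>enat n\<close>.\<close>
  have "A \<noteq> {}"
    using le by (auto simp: covering_number_def A_def[symmetric] top_enat_def)
  then have "covering_number X d C r \<in> A"
    unfolding covering_number_def A_def[symmetric] by (meson all_not_in_conv wellorder_InfI)
  then obtain P where "covering_number X d C r = enat (card P)" "finite P" "P \<subseteq> C"
    "C \<subseteq> (\<Union>x\<in>P. qcball X d x r)"
    unfolding A_def by auto
  with le show "\<exists>P. finite P \<and> card P \<le> n \<and> P \<subseteq> C \<and> C \<subseteq> (\<Union>x\<in>P. qcball X d x r)"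
    by auto
next
  assume "\<exists>P. finite P \<and> card P \<le> n \<and> P \<subseteq> C \<and> C \<subseteq> (\<Union>x\<in>P. qcball X d x r)"
  then obtain P where P: "finite P" "card P \<le> n" "P \<subseteq> C" "C \<subseteq> (\<Union>x\<in>P. qcball X d x r)"
    by blast
  then have "covering_number X d C r \<le> enat (card P)"
    unfolding covering_number_def by (intro Inf_lower) blast
  with P(2) show "covering_number X d C r \<le> enat n"
    by (meson enat_ord_simps(1) order_trans)
qed

lemma covering_number_finite:
  assumes "qtotally_bounded X d C" and "r > 0"
  obtains N where "covering_number X d C r = enat N"
proof -
  from assms have "\<exists>P. finite P \<and> P \<subseteq> C \<and> C \<subseteq> (\<Union>x\<in>P. qcball X d x r)"
    by (simp add: qtotally_bounded_def)
  then obtain P where "finite P" "P \<subseteq> C" "C \<subseteq> (\<Union>x\<in>P. qcball X d x r)"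
    by (elim exE conjE)
  then have "covering_number X d C r \<le> enat (card P)"
    unfolding covering_number_le_iff by blast
  then show ?thesis
    using that enat_ile by blast
qed

lemma covering_number_le_1:
  assumes "C \<noteq> {}" "C \<subseteq> X" "\<And>x y. x \<in> C \<Longrightarrow> y \<in> C \<Longrightarrow> d x y \<le> r"
  shows "covering_number X d C r \<le> enat 1"
proof -
  from assms(1) obtain p where "p \<in> C" by blast
  then show ?thesis
    unfolding covering_number_le_iff using assms
    by (intro exI[of _ "{p}"]) (auto simp: qcball_def)
qed

text \<open>Two points of one ball of radius \<open>r\<close> are at most \<open>2 * k * r\<close>
  apart, so a single small ball cannot contain both \<open>x\<close> and \<open>y\<close>.\<close>

lemma eventually_covering_number_ge_2:
  assumes "quasi_metric_on X d" "C \<subseteq> X" and xy: "x \<in> C" "y \<in> C" "x \<noteq> y"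
  shows "\<forall>\<^sub>F r in at_right 0. enat 2 \<le> covering_number X d C r"
proof -
  obtain k where k: "k \<ge> 1"
    "\<And>x y z. x \<in> X \<Longrightarrow> y \<in> X \<Longrightarrow> z \<in> X \<Longrightarrow> d x z \<le> k * (d x y + d y z)"
    using quasi_metric_on_triangle[OF assms(1)] by metis
  have X: "x \<in> X" "y \<in> X"
    using xy assms(2) by auto
  have pos: "d x y / (2 * k) > 0"
    using k(1) quasi_metric_onD(1,2)[OF assms(1) X] xy(3) by simp
  have "enat 2 \<le> covering_number X d C r" if r: "r < d x y / (2 * k)" for r
  proof (rule ccontr)
    assume "\<not> ?thesis"
    then have "covering_number X d C r \<le> enat 1"
      by (metis not_le one_add_one plus_1_eSuc(2) ileI1 iless_Suc_eq numeral_2_eq_2 eSuc_enat One_nat_def)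
    then obtain P where P: "finite P" "card P \<le> 1" "P \<subseteq> C" "C \<subseteq> (\<Union>x\<in>P. qcball X d x r)"
      unfolding covering_number_le_iff by blast
    \<comment> \<open>The cardinality bound still admits the empty cover; this is excluded because
      \<open>x\<close> has to be covered.\<close>
    from P(1,2,4) xy(1) obtain p where "P = {p}"
      by (metis One_nat_def UN_E all_not_in_conv card_1_singletonE card_gt_0_iff le_antisym less_eq_Suc_le subsetD)
    then have p: "p \<in> X" "d p x \<le> r" "d p y \<le> r"
      using P xy assms(2) by (auto simp: qcball_def)
    have "d x y \<le> k * (d x p + d p y)"
      by (rule k(2)) (use X p in auto)
    also have "\<dots> \<le> k * (r + r)"
      using k(1) p quasi_metric_on_commute[OF assms(1) X(1) p(1)] by (intro mult_left_mono) auto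
    finally show False
      using r k(1) by (simp add: field_simps)
  qed
  then show ?thesis
    unfolding eventually_at_right_field using pos by blast
qed

section \<open>From dimensions to covering numbers\<close>

text \<open>For radii below 1 and covering number at least 2, both the double logarithm and the
  denominator are nonnegative. The sign is what allows inequalities to be reversed when passing to
  the reciprocal of the dimension.\<close>

lemma lower_dim_exp_nonneg:
  assumes "quasi_metric_on X d" "C \<subseteq> X"
  shows "0 \<le> lower_dim_exp X d C"
proof (cases "(\<exists>x\<in>C. \<exists>y\<in>C. x \<noteq> y) \<and> qtotally_bounded X d C")
  case True
  then obtain x y where xy: "x \<in> C" "y \<in> C" "x \<noteq> y" and tb: "qtotally_bounded X d C"
    by blast
  have "\<forall>\<^sub>F r in at_right 0. (0::real) < r \<and> r < 1"
    unfolding eventually_at_right_field by (auto intro: exI[of _ 1])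
  with eventually_covering_number_ge_2[OF assms xy]
  have "\<forall>\<^sub>F r in at_right 0. 0 \<le> log_log_ratio X d C r"
  proof eventually_elim
    case (elim r)
    from elim obtain N where N: "covering_number X d C r = enat N"
      using covering_number_finite[OF tb] by blast
    with elim have "2 \<le> N" by simp
    then have "log 2 2 \<le> log 2 (real N)"
      by (subst log_le_cancel_iff) auto
    then have "0 \<le> log 2 (log 2 (real N))"
      by (subst zero_le_log_cancel_iff) auto
    moreover have "0 \<le> log 2 (1 / r)"
      using elim by (subst zero_le_log_cancel_iff) auto
    ultimately show ?case
      unfolding log_log_ratio_def N by simp
  qed
  then have "0 \<le> Liminf (at_right 0) (log_log_ratio X d C)"
    by (rule Liminf_bounded)
  with True show ?thesis by (auto simp: lower_dim_exp_def)
qed (auto simp: lower_dim_exp_def)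

text \<open>Unfolds the limsup: a ratio below \<open>1 / t\<close> becomes
  \<open>log 2 N < r powr (- 1 / t)\<close> after multiplying by \<open>log 2 (1 / r)\<close> and
  removing one logarithm. A singleton, whose dimension is 0 by convention, is covered by one ball
  directly.\<close>

lemma eventually_covering_number_le:
  assumes "quasi_metric_on X d" "C \<noteq> {}" "C \<subseteq> X"
    and t: "t > 0" "upper_dim_exp X d C < ereal (1 / t)"
  shows "\<forall>\<^sub>F r in at_right 0. \<exists>N. covering_number X d C r \<le> enat N \<and>
    real N \<le> 2 powr (r powr (- 1 / t))"
proof (cases "\<exists>x\<in>C. \<exists>y\<in>C. x \<noteq> y")
  case False
  have "\<exists>N. covering_number X d C r \<le> enat N \<and> real N \<le> 2 powr (r powr (- 1 / t))"
    if "r > 0" for r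
  proof -
    have "d x y \<le> r" if "x \<in> C" "y \<in> C" for x y
    proof -
      from False that have "x = y" by blast
      then have "d x y = 0"
        using quasi_metric_on_zero_iff[OF assms(1)] assms(3) that by auto
      with \<open>r > 0\<close> show ?thesis by simp
    qed
    then have "covering_number X d C r \<le> enat 1"
      by (rule covering_number_le_1[OF assms(2,3)])
    moreover have "real 1 \<le> 2 powr (r powr (- 1 / t))"
      by (simp add: ge_one_powr_ge_zero)
    ultimately show ?thesis by blast
  qed
  then show ?thesis
    unfolding eventually_at_right_field by (auto intro: exI[of _ 1])
next
  case True
  \<comment> \<open>Without total boundedness the dimension would be \<infinity>, contradicting the
    finite bound \<open>1 / t\<close>.\<close>
  have tb: "qtotally_bounded X d C"
    using True t(2) by (auto simp: upper_dim_exp_def split: if_splits)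
  have "Limsup (at_right 0) (log_log_ratio X d C) < ereal (1 / t)"
    using True tb t(2) by (auto simp: upper_dim_exp_def split: if_splits)
  then have "\<forall>\<^sub>F r in at_right 0. log_log_ratio X d C r < ereal (1 / t)"
    by (rule Limsup_lessD)
  moreover have "\<forall>\<^sub>F r in at_right 0. (0::real) < r \<and> r < 1"
    unfolding eventually_at_right_field by (auto intro: exI[of _ 1])
  ultimately show ?thesis
  proof eventually_elim
    case (elim r)
    then obtain N where N: "covering_number X d C r = enat N"
      using covering_number_finite[OF tb] by blast
    have "real N \<le> 2 powr (r powr (- 1 / t))"
    \<comment> \<open>For \<open>N \<le> 1\<close> the inner logarithm need not be positive, so the
      outer one cannot be undone; here the right-hand side is at least 1 anyway.\<close>
    proof (cases "N \<le> 1")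
      case True
      then have "real N \<le> 1" by simp
      also have "1 \<le> 2 powr (r powr (- 1 / t))"
        by (simp add: ge_one_powr_ge_zero)
      finally show ?thesis .
    next
      case False
      then have L: "log 2 (real N) > 0" by simp
      have "log 2 (1 / r) > 0"
        using elim by (subst zero_less_log_cancel_iff) auto
      then have "log 2 (log 2 (real N)) < 1 / t * log 2 (1 / r)"
        using elim(1) by (simp add: log_log_ratio_def N divide_less_eq)
      also have "\<dots> = log 2 (r powr (- 1 / t))"
        using elim by (simp add: log_powr log_divide)
      finally have "log 2 (real N) < r powr (- 1 / t)"
        using L elim by (subst (asm) log_less_cancel_iff) auto
      then show ?thesis
        using False by (simp add: log_less_iff)
    qed
    with N show ?case by auto
  qed
qed

text \<open>At the radius \<open>r = n powr (- t)\<close> the exponent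
  \<open>r powr (- 1 / t)\<close> is exactly \<open>n\<close>. The transfer to sequences requires
  these radii to tend to 0 through positive values.\<close>

lemma eventually_covering_number_le_power:
  assumes "quasi_metric_on X d" "C \<noteq> {}" "C \<subseteq> X"
    and t: "t > 0" "upper_dim_exp X d C < ereal (1 / t)"
  shows "\<forall>\<^sub>F n in sequentially. covering_number X d C (real n powr (- t)) \<le> enat (2 ^ n)"
proof -
  have lim: "filterlim (\<lambda>n. real n powr (- t)) (at_right 0) sequentially"
    unfolding filterlim_at
  proof
    show "\<forall>\<^sub>F n in sequentially. real n powr (- t) \<in> {0<..} \<and> real n powr (- t) \<noteq> 0"
      using eventually_gt_at_top[of 0] by eventually_elim simp
    show "(\<lambda>n. real n powr (- t)) \<longlonglongrightarrow> 0"
      using t(1) by (intro tendsto_neg_powr filterlim_real_sequentially) auto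
  qed
  have "\<forall>\<^sub>F n in sequentially. \<exists>N. covering_number X d C (real n powr (- t)) \<le> enat N \<and>
      real N \<le> 2 powr ((real n powr (- t)) powr (- 1 / t))"
    using eventually_covering_number_le[OF assms] lim by (rule eventually_compose_filterlim)
  then show ?thesis
    using eventually_gt_at_top[of 0]
  proof eventually_elim
    case (elim n)
    then obtain N where N: "covering_number X d C (real n powr (- t)) \<le> enat N"
      "real N \<le> 2 powr ((real n powr (- t)) powr (- 1 / t))"
      by blast
    have "(real n powr (- t)) powr (- 1 / t) = real n"
      using elim t(1) by (simp add: powr_powr)
    with N(2) have "real N \<le> real (2 ^ n)"
      by (simp add: powr_realpow)
    then have "N \<le> 2 ^ n"
      by linarith
    with N(1) show ?case
      by (meson enat_ord_simps(1) order_trans)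
  qed
qed

section \<open>Achievability\<close>

text \<open>The centres of the cover are injected into the words of length \<open>n\<close>; the
  encoder sends a point to the word of a centre whose ball contains it.\<close>

lemma codec_from_cover:
  assumes "quasi_metric_on X d" "C \<noteq> {}" "C \<subseteq> X"
    and "covering_number X d C r \<le> enat (2 ^ n)"
  obtains ED where "codec_for X C n ED" "\<And>x. x \<in> C \<Longrightarrow> d x (reconstruct ED x) \<le> r"
proof -
  define B where "B = {b::bool list. length b = n}"
  have B: "finite B" "card B = 2 ^ n"
    using finite_lists_length_eq[of "UNIV :: bool set" n]
      card_lists_length_eq[of "UNIV :: bool set" n]
    by (auto simp: B_def)
  from assms(4) obtain P where P: "finite P" "card P \<le> 2 ^ n" "P \<subseteq> C"
    "C \<subseteq> (\<Union>x\<in>P. qcball X d x r)"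
    unfolding covering_number_le_iff by blast
  obtain f where f: "f ` P \<subseteq> B" "inj_on f P"
    using P(1,2) B by (metis inj_on_iff_card_le)
  have "\<forall>x\<in>C. \<exists>p\<in>P. d p x \<le> r"
    using P(4) by (auto simp: qcball_def)
  then obtain g where g: "\<And>x. x \<in> C \<Longrightarrow> g x \<in> P" "\<And>x. x \<in> C \<Longrightarrow> d (g x) x \<le> r"
    by metis
  obtain p where p: "p \<in> X"
    using assms(2,3) by blast
  \<comment> \<open>Words that address no centre decode to the arbitrary point \<open>p\<close>, so
    that the decoder maps every word into \<open>X\<close>.\<close>
  define ED where "ED = (f \<circ> g, \<lambda>b. if b \<in> f ` P then inv_into P f b else p)"
  have "inv_into P f b \<in> X" if "b \<in> f ` P" for b
    using inv_into_into[OF that] P(3) assms(3) by blast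
  moreover have "f (g x) \<in> B" if "x \<in> C" for x
    using f(1) g(1)[OF that] by blast
  ultimately have "codec_for X C n ED"
    using p by (auto simp: codec_for_def ED_def B_def)
  moreover have "d x (reconstruct ED x) \<le> r" if "x \<in> C" for x
  proof -
    have "reconstruct ED x = g x"
      using f(2) g(1)[OF that] by (simp add: reconstruct_def ED_def)
    moreover have "d x (g x) = d (g x) x"
      using assms(3) P(3) g(1)[OF that] that by (intro quasi_metric_on_commute[OF assms(1)]) auto
    ultimately show ?thesis using g(2)[OF that] by simp
  qed
  ultimately show ?thesis by (rule that)
qed

text \<open>A uniform distortion bound makes \<open>K\<close> an upper bound of the supremum at
  every point, since \<open>n powr t\<close> cancels \<open>n powr (- t)\<close>.\<close>

lemma rate_class_eqI:
  assumes "K > 0" and "\<And>n. n \<ge> 1 \<Longrightarrow> distortion d C (S n) \<le> ereal (K * real n powr (- t))"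
  shows "rate_class d C S t = C"
proof -
  have "(SUP n\<in>{1..}. ereal (real n powr t * d x (reconstruct (S n) x))) < \<infinity>"
    if "x \<in> C" for x
  proof (rule le_less_trans[OF SUP_least])
    fix n :: nat
    assume n: "n \<in> {1..}"
    have "ereal (d x (reconstruct (S n) x)) \<le> distortion d C (S n)"
      unfolding distortion_def using that by (rule SUP_upper)
    with assms(2) n have "d x (reconstruct (S n) x) \<le> K * real n powr (- t)"
      by (metis atLeast_iff ereal_less_eq(3) order_trans)
    then have "real n powr t * d x (reconstruct (S n) x) \<le> real n powr t * (K * real n powr (- t))"
      by (intro mult_left_mono) auto
    also have "\<dots> = K"
      using n by (simp add: powr_minus)
    finally show "ereal (real n powr t * d x (reconstruct (S n) x)) \<le> ereal K" by simp
  qed simp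
  then show ?thesis
    unfolding rate_class_def by blast
qed

section \<open>Reciprocals of extended reals\<close>

text \<open>For \<open>D \<le> 0\<close> the conclusion follows from \<open>1 / t > 0\<close> alone,
  and \<open>D = \<infinity>\<close> is excluded because its inverse is 0.\<close>

lemma less_inverse_ereal:
  assumes "0 < t" and less: "ereal t < inverse D"
  shows "D < ereal (1 / t)"
proof (cases D)
  case (real r)
  show ?thesis
  proof (cases "r \<le> 0")
    case True
    then show ?thesis
      using assms(1) real by (simp add: le_less_trans[of r 0])
  next
    case False
    then have "t < 1 / r"
      using less real by (simp add: inverse_eq_divide)
    then show ?thesis
      using False assms(1) real by (simp add: field_simps)
  qed
qed (use less assms(1) in auto)

text \<open>\<open>D = 0\<close> is excluded because its inverse is \<infinity>. A negative real
  \<open>D\<close> would have a negative inverse and so permit \<open>t \<le> 0\<close>.\<close>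

lemma inverse_less_ereal:
  assumes "0 \<le> D" and less: "inverse D < ereal t"
  shows "0 < t" and "ereal (1 / t) < D"
proof -
  have "0 < t \<and> ereal (1 / t) < D"
  proof (cases D)
    case (real r)
    show ?thesis
    proof (cases "r = 0")
      case True
      then show ?thesis
        using less real by simp
    next
      case False
      then have r: "r > 0"
        using assms(1) real by simp
      then have "1 / r < t"
        using less real by (simp add: inverse_eq_divide)
      moreover have "0 < 1 / r"
        using r by simp
      ultimately have "0 < t" by linarith
      with r \<open>1 / r < t\<close> show ?thesis
        using real by (simp add: field_simps)
    qed
  qed (use less assms(1) in auto)
  then show "0 < t" and "ereal (1 / t) < D" by auto
qed

section \<open>One codec sequence for all rates\<close>

lemma achievability:
  assumes "quasi_metric_on X d" "C \<noteq> {}" "C \<subseteq> X" "qbounded d C"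
  obtains S where "codec_seq_for X C S"
    "\<And>t. 0 \<le> t \<Longrightarrow> ereal t < inverse (upper_dim_exp X d C) \<Longrightarrow>
       \<exists>K>0. \<forall>n\<ge>1. distortion d C (S n) \<le> ereal (K * real n powr (- t))"
proof -
  \<comment> \<open>The radii that \<open>n\<close> bits can realize. They do not depend on
    \<open>t\<close>, and neither will the codecs.\<close>
  define R where "R n = {r. r > 0 \<and> covering_number X d C r \<le> enat (2 ^ n)}" for n :: nat
  obtain b0 where b0: "\<And>x y. x \<in> C \<Longrightarrow> y \<in> C \<Longrightarrow> d x y \<le> b0"
    using assms(4) unfolding qbounded_def by blast
  define b where "b = max b0 1"
  \<comment> \<open>Boundedness puts \<open>C\<close> into one ball, so no \<open>R n\<close> is
    empty; the maximum with 1 keeps \<open>b\<close> positive.\<close>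
  have "covering_number X d C b \<le> enat 1"
    by (rule covering_number_le_1[OF assms(2,3)]) (use b0 in \<open>fastforce simp: b_def\<close>)
  moreover have "enat 1 \<le> enat (2 ^ n)" for n
    by simp
  ultimately have bR: "b \<in> R n" for n
    unfolding R_def b_def by (auto intro: order_trans)
  have bdd: "bdd_below (R n)" for n
    unfolding R_def by (rule bdd_belowI[of _ 0]) auto
  have "\<exists>ED. codec_for X C n ED \<and>
      (\<forall>r\<in>R n. distortion d C ED \<le> ereal (r + real n powr (- real n)))" if "n \<ge> 1" for n
  proof -
    \<comment> \<open>The infimum need not be attained, hence some slack. The slack
      \<open>n powr (- n)\<close> is eventually below \<open>n powr (- t)\<close> for every fixed
      \<open>t\<close>.\<close>
    have "Inf (R n) < Inf (R n) + real n powr (- real n)"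
      using that by simp
    then obtain \<rho> where \<rho>: "\<rho> \<in> R n" "\<rho> < Inf (R n) + real n powr (- real n)"
      using cInf_lessD[of "R n"] bR by blast
    from \<rho>(1) obtain ED where ED: "codec_for X C n ED"
      "\<And>x. x \<in> C \<Longrightarrow> d x (reconstruct ED x) \<le> \<rho>"
      using codec_from_cover[OF assms(1-3)] unfolding R_def by blast
    have "distortion d C ED \<le> ereal (r + real n powr (- real n))" if "r \<in> R n" for r
      unfolding distortion_def
    proof (rule SUP_least)
      fix x assume "x \<in> C"
      then show "ereal (d x (reconstruct ED x)) \<le> ereal (r + real n powr (- real n))"
        using ED(2)[of x] \<rho>(2) cInf_lower[OF that bdd] by simp
    qed
    with ED(1) show ?thesis by blast
  qed
  then obtain S where S: "\<And>n. n \<ge> 1 \<Longrightarrow> codec_for X C n (S n)"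
    "\<And>n r. n \<ge> 1 \<Longrightarrow> r \<in> R n \<Longrightarrow> distortion d C (S n) \<le> ereal (r + real n powr (- real n))"
    by metis
  have "\<exists>K>0. \<forall>n\<ge>1. distortion d C (S n) \<le> ereal (K * real n powr (- t))"
    if t: "0 \<le> t" "ereal t < inverse (upper_dim_exp X d C)" for t
  proof -
    \<comment> \<open>At \<open>t = 0\<close> there is no reciprocal \<open>1 / t\<close> to compare
      with the dimension; that rate follows from boundedness.\<close>
    have "\<forall>\<^sub>F n in sequentially. t = 0 \<or> real n powr (- t) \<in> R n"
    proof (cases "t = 0")
      case False
      with t(1) have "t > 0" by simp
      moreover from this t(2) have "upper_dim_exp X d C < ereal (1 / t)"
        by (rule less_inverse_ereal)
      ultimately have "\<forall>\<^sub>F n in sequentially. covering_number X d C (real n powr (- t)) \<le> enat (2 ^ n)"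
        by (rule eventually_covering_number_le_power[OF assms(1-3)])
      then
      show ?thesis
        using eventually_gt_at_top[of 0] by eventually_elim (simp add: R_def)
    qed simp
    then have "\<forall>\<^sub>F n in sequentially. (t = 0 \<or> real n powr (- t) \<in> R n) \<and> n \<ge> nat \<lceil>t\<rceil>"
      using eventually_ge_at_top by (rule eventually_conj)
    then obtain n0 where n0: "\<And>n. n \<ge> n0 \<Longrightarrow> t = 0 \<or> real n powr (- t) \<in> R n"
      "\<And>n. n \<ge> n0 \<Longrightarrow> n \<ge> nat \<lceil>t\<rceil>"
      unfolding eventually_sequentially by blast
    \<comment> \<open>\<open>b + 1\<close> bounds the distortion for all \<open>n \<ge> 1\<close>,
      and the second factor compensates \<open>n powr (- t)\<close> for \<open>n < n0\<close>.
      \<open>Suc\<close> keeps the base at least 1, whence \<open>K \<ge> 2\<close>, which absorbs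
      radius plus slack for large \<open>n\<close>.\<close>
    define K where "K = (b + 1) * real (Suc n0) powr t"
    have b1: "b \<ge> 1" by (simp add: b_def)
    have powr_ge_1: "real (Suc n0) powr t \<ge> 1"
      using t(1) by (simp add: ge_one_powr_ge_zero)
    have K2: "K \<ge> 2"
      using mult_mono[of 2 "b + 1" 1 "real (Suc n0) powr t"] b1 powr_ge_1 by (simp add: K_def)
    have "distortion d C (S n) \<le> ereal (K * real n powr (- t))" if n: "n \<ge> 1" for n
    proof (cases "n \<ge> n0 \<and> t \<noteq> 0")
      case True
      have "distortion d C (S n) \<le> ereal (real n powr (- t) + real n powr (- real n))"
        using S(2)[OF n] n0(1)[of n] True by blast
      also have "real n powr (- real n) \<le> real n powr (- t)"
        using n n0(2)[of n] True by (intro powr_mono) (auto simp: nat_le_iff ceiling_le_iff)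
      also have "real n powr (- t) + real n powr (- t) \<le> K * real n powr (- t)"
        using mult_right_mono[OF K2, of "real n powr (- t)"] by simp
      finally show ?thesis by simp
    next
      case False
      \<comment> \<open>For small \<open>n\<close>, or \<open>t = 0\<close>, the crude radius
        \<open>b\<close> suffices.\<close>
      have "distortion d C (S n) \<le> ereal (b + real n powr (- real n))"
        by (rule S(2)[OF n bR])
      also have "real n powr (- real n) \<le> real n powr 0"
        using n by (intro powr_mono) auto
      also have "b + real n powr 0 = (b + 1) * 1"
        using n by simp
      also have "(b + 1) * 1 \<le> (b + 1) * (real (Suc n0) powr t * real n powr (- t))"
      proof (rule mult_left_mono)
        have "real n powr t \<le> real (Suc n0) powr t"
          using False t(1) n by (cases "t = 0") (auto intro!: powr_mono2)
        then show "1 \<le> real (Suc n0) powr t * real n powr (- t)"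
          using n by (simp add: powr_minus field_simps)
      qed (use b1 in simp)
      finally show ?thesis
        by (simp add: K_def mult.assoc)
    qed
    with K2 show ?thesis by (intro exI[of _ K]) auto
  qed
  moreover have "codec_seq_for X C S"
    using S(1) by (simp add: codec_seq_for_def)
  ultimately show ?thesis using that by blast
qed

section \<open>Converse\<close>

text \<open>Both constants come from the small-ball condition alone, hence are uniform in
  \<open>n\<close> and in the codec. Dividing by \<open>ln 2\<close> changes the base from e to
  2.\<close>

lemma codec_outer_measure_bound:
  assumes "quasi_metric_on X d" "C \<subseteq> X" "space \<mu> = X" "small_ball X d \<mu> s"
  shows "\<exists>c>0. \<exists>\<epsilon>0>0. \<forall>n ED. codec_for X C n ED \<longrightarrow>
    (\<forall>\<epsilon>. 0 < \<epsilon> \<and> \<epsilon> < \<epsilon>0 \<longrightarrow>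
       outer_measure_of \<mu> {x\<in>C. d x (reconstruct ED x) \<le> \<epsilon>}
         \<le> ennreal (2 powr (real n - c * \<epsilon> powr (- s))))"
proof -
  from assms(4) obtain c r0 where c: "c > 0" "r0 > 0"
    "\<And>x r. x \<in> X \<Longrightarrow> 0 < r \<Longrightarrow> r < r0 \<Longrightarrow>
       outer_measure_of \<mu> (qcball X d x r) \<le> ennreal (exp (- c * (1 / r) powr s))"
    unfolding small_ball_def by blast
  have "outer_measure_of \<mu> {x\<in>C. d x (reconstruct ED x) \<le> \<epsilon>}
      \<le> ennreal (2 powr (real n - c / ln 2 * \<epsilon> powr (- s)))"
    if ED: "codec_for X C n ED" and \<epsilon>: "0 < \<epsilon>" "\<epsilon> < r0" for n ED \<epsilon>
  proof -
    define B where "B = {b::bool list. length b = n}"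
    have B: "finite B" "card B = 2 ^ n"
      using finite_lists_length_eq[of "UNIV :: bool set" n]
        card_lists_length_eq[of "UNIV :: bool set" n]
      by (auto simp: B_def)
    have enc: "fst ED x \<in> B" if "x \<in> C" for x
      using ED that by (auto simp: codec_for_def B_def)
    have dec: "snd ED b \<in> X" if "b \<in> B" for b
      using ED that by (auto simp: codec_for_def B_def)
    have "{x\<in>C. d x (reconstruct ED x) \<le> \<epsilon>} \<subseteq> (\<Union>b\<in>B. qcball X d (snd ED b) \<epsilon>)"
    proof
      fix x assume x: "x \<in> {x\<in>C. d x (reconstruct ED x) \<le> \<epsilon>}"
      then have "x \<in> X" "snd ED (fst ED x) \<in> X"
        using assms(2) dec[OF enc] by auto
      \<comment> \<open>The error is measured from \<open>x\<close>, whereas the ball is centred at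
        the decoded point.\<close>
      then have "d (snd ED (fst ED x)) x = d x (snd ED (fst ED x))"
        by (intro quasi_metric_on_commute[OF assms(1)])
      with x have "x \<in> qcball X d (snd ED (fst ED x)) \<epsilon>"
        using assms(2) by (auto simp: qcball_def reconstruct_def)
      with x show "x \<in> (\<Union>b\<in>B. qcball X d (snd ED b) \<epsilon>)"
        using enc by blast
    qed
    then have "outer_measure_of \<mu> {x\<in>C. d x (reconstruct ED x) \<le> \<epsilon>}
        \<le> outer_measure_of \<mu> (\<Union>b\<in>B. qcball X d (snd ED b) \<epsilon>)"
      by (rule outer_measure_of_mono)
    also have "\<dots> \<le> (\<Sum>b\<in>B. outer_measure_of \<mu> (qcball X d (snd ED b) \<epsilon>))"
      using B(1) assms(3) by (intro outer_measure_of_UN_le) (auto simp: qcball_def)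
    also have "\<dots> \<le> (\<Sum>b\<in>B. ennreal (exp (- c * (1 / \<epsilon>) powr s)))"
      using c(3) dec \<epsilon> by (intro sum_mono) auto
    also have "\<dots> = ennreal (2 ^ n * exp (- c * (1 / \<epsilon>) powr s))"
      by (simp add: B(2) ennreal_mult' flip: ennreal_power)
    also have "2 ^ n * exp (- c * (1 / \<epsilon>) powr s) = 2 powr (real n - c / ln 2 * \<epsilon> powr (- s))"
    proof -
      have "(1 / \<epsilon>) powr s = \<epsilon> powr (- s)"
        using \<epsilon>(1) by (simp add: powr_divide powr_minus_divide)
      then show ?thesis
        by (simp add: powr_diff powr_realpow) (simp add: powr_def exp_minus field_simps)
    qed
    finally show ?thesis .
  qed
  then show ?thesis
    using c(1,2) by (intro exI[of _ "c / ln 2"] exI[of _ r0] conjI) auto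
qed

text \<open>The strict gap \<open>u < t\<close> makes \<open>t / u > 1\<close>, so the term
  \<open>n powr (t / u)\<close> outgrows the \<open>n\<close> contributed by the number of
  words.\<close>

lemma rate_class_outer_measure_0:
  assumes "quasi_metric_on X d" "C \<subseteq> X" "space \<mu> = X" "codec_seq_for X C S"
    and "0 < u" "u < t" "small_ball X d \<mu> (1 / u)"
  shows "outer_measure_of \<mu> (rate_class d C S t) = 0"
proof -
  obtain c \<epsilon>0 where c: "c > 0" "\<epsilon>0 > 0"
    "\<forall>n ED. codec_for X C n ED \<longrightarrow>
      (\<forall>\<epsilon>. 0 < \<epsilon> \<and> \<epsilon> < \<epsilon>0 \<longrightarrow>
         outer_measure_of \<mu> {x\<in>C. d x (reconstruct ED x) \<le> \<epsilon>}
           \<le> ennreal (2 powr (real n - c * \<epsilon> powr (- (1 / u)))))"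
    using codec_outer_measure_bound[OF assms(1-3,7)] by (elim exE conjE)
  \<comment> \<open>Integer constants suffice, so the rate class is a countable union.
    \<open>Suc K\<close> keeps the radius positive, as the small-ball condition requires.\<close>
  define A where "A K = {x\<in>C. \<forall>n\<ge>1. d x (reconstruct (S n) x) \<le> real (Suc K) * real n powr (- t)}"
    for K :: nat
  have sub: "rate_class d C S t \<subseteq> (\<Union>K\<in>UNIV. A K)"
  proof
    fix x assume x: "x \<in> rate_class d C S t"
    then have "(SUP n\<in>{1..}. ereal (real n powr t * d x (reconstruct (S n) x))) \<noteq> \<infinity>"
      by (simp add: rate_class_def)
    then obtain K where K: "(SUP n\<in>{1..}. ereal (real n powr t * d x (reconstruct (S n) x))) < ereal (real K)"
      unfolding less_PInf_Ex_of_nat by (elim exE)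
    have "d x (reconstruct (S n) x) \<le> real (Suc K) * real n powr (- t)" if n: "n \<ge> 1" for n
    proof -
      have "ereal (real n powr t * d x (reconstruct (S n) x))
          \<le> (SUP n\<in>{1..}. ereal (real n powr t * d x (reconstruct (S n) x)))"
        using n by (intro SUP_upper) auto
      also note K
      finally have "real n powr t * d x (reconstruct (S n) x) \<le> real (Suc K)"
        by simp
      then show ?thesis
        using n by (simp add: powr_minus field_simps)
    qed
    then have "x \<in> A K"
      using x by (simp add: A_def rate_class_def)
    then show "x \<in> (\<Union>K\<in>UNIV. A K)"
      by blast
  qed
  have A0: "outer_measure_of \<mu> (A K) = 0" for K
  proof -
    \<comment> \<open>The coefficient left after substituting
      \<open>\<epsilon> = Suc K * n powr (- t)\<close> into
      \<open>c * \<epsilon> powr (- (1 / u))\<close>.\<close>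
    define a where "a = c * real (Suc K) powr (- (1 / u))"
    have a: "a > 0"
      using c(1) by (simp add: a_def)
    have "(\<lambda>n. real (Suc K) * real n powr (- t)) \<longlonglongrightarrow> real (Suc K) * 0"
      using assms(5,6) by (intro tendsto_mult tendsto_const tendsto_neg_powr filterlim_real_sequentially) auto
    then have "\<forall>\<^sub>F n in sequentially. real (Suc K) * real n powr (- t) < \<epsilon>0"
      using c(2) by (intro order_tendstoD(2)) auto
    then have "\<forall>\<^sub>F n in sequentially.
        outer_measure_of \<mu> (A K) \<le> ennreal (2 powr (real n - a * real n powr (t / u)))"
      using eventually_gt_at_top[of 0]
    proof eventually_elim
      case (elim n)
      define \<epsilon> where "\<epsilon> = real (Suc K) * real n powr (- t)"
      have "outer_measure_of \<mu> (A K) \<le> outer_measure_of \<mu> {x\<in>C. d x (reconstruct (S n) x) \<le> \<epsilon>}"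
        using elim(2) by (intro outer_measure_of_mono) (auto simp: A_def \<epsilon>_def)
      also have "\<dots> \<le> ennreal (2 powr (real n - c * \<epsilon> powr (- (1 / u))))"
        using elim assms(4) by (intro c(3)[rule_format]) (auto simp: \<epsilon>_def codec_seq_for_def)
      also have "c * \<epsilon> powr (- (1 / u)) = a * real n powr (t / u)"
        unfolding \<epsilon>_def a_def by (subst powr_mult) (simp_all add: powr_powr)
      finally show ?case .
    qed
    moreover have "(\<lambda>n. ennreal (2 powr (real n - a * real n powr (t / u)))) \<longlonglongrightarrow> ennreal 0"
    proof (rule tendsto_ennrealI)
      have "t / u > 1" using assms(5,6) by simp
      with a show "(\<lambda>n. 2 powr (real n - a * real n powr (t / u))) \<longlonglongrightarrow> 0"
        by real_asymp
    qed
    \<comment> \<open>The left side does not depend on \<open>n\<close>, so it is bounded by the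
      limit.\<close>
    ultimately have "outer_measure_of \<mu> (A K) \<le> ennreal 0"
      by (intro tendsto_lowerbound[where F = sequentially]) auto
    then show ?thesis by simp
  qed
  have "outer_measure_of \<mu> (\<Union>K\<in>UNIV. A K) = 0"
  proof (rule outer_measure_of_UN_eq_0)
    show "A K \<subseteq> space \<mu>" for K
      using assms(2,3) by (auto simp: A_def)
  qed (simp_all add: A0)
  with outer_measure_of_mono[OF sub, of \<mu>] show ?thesis by simp
qed

section \<open>All rates above the threshold\<close>

text \<open>For \<open>n \<ge> 1\<close> a smaller exponent gives a smaller weight on a nonnegative
  distance. This lets the uncountable union over rates be replaced by a countable one.\<close>

lemma rate_class_antimono:
  assumes "quasi_metric_on X d" "C \<subseteq> X" "codec_seq_for X C S" "s \<le> t"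
  shows "rate_class d C S t \<subseteq> rate_class d C S s"
proof
  fix x assume x: "x \<in> rate_class d C S t"
  have "(SUP n\<in>{1..}. ereal (real n powr s * d x (reconstruct (S n) x)))
      \<le> (SUP n\<in>{1..}. ereal (real n powr t * d x (reconstruct (S n) x)))"
  proof (rule SUP_mono)
    fix n :: nat assume n: "n \<in> {1..}"
    have "x \<in> X" "reconstruct (S n) x \<in> X"
      using x n assms(2,3) by (fastforce simp: rate_class_def codec_seq_for_def codec_for_def reconstruct_def)+
    then have "0 \<le> d x (reconstruct (S n) x)"
      by (rule quasi_metric_on_nonneg[OF assms(1)])
    then have "real n powr s * d x (reconstruct (S n) x) \<le> real n powr t * d x (reconstruct (S n) x)"
      using n assms(4) by (intro mult_right_mono powr_mono) auto
    with n show "\<exists>m\<in>{1..}. ereal (real n powr s * d x (reconstruct (S n) x))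
        \<le> ereal (real m powr t * d x (reconstruct (S m) x))"
      by (intro bexI[of _ n]) auto
  qed
  also have "\<dots> < \<infinity>"
    using x by (simp add: rate_class_def)
  finally show "x \<in> rate_class d C S s"
    using x by (simp add: rate_class_def)
qed

text \<open>Passing to the reciprocal places \<open>1 / t\<close> strictly between 0 and the lower
  dimension, the range in which criticality supplies the small-ball condition.\<close>

lemma critical_measure_small_ball:
  assumes "quasi_metric_on X d" "C \<subseteq> X" "critical_measure X d C \<mu>"
    and "inverse (lower_dim_exp X d C) < ereal t"
  shows "t > 0" "small_ball X d \<mu> (1 / t)"
proof -
  note * = inverse_less_ereal[OF lower_dim_exp_nonneg[OF assms(1,2)] assms(4)]
  show "t > 0" by (fact *(1))
  with assms(3) *(2) show "small_ball X d \<mu> (1 / t)"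
    by (simp add: critical_measure_def)
qed

theorem theorem1p10:
  fixes X :: "'a set" and d :: "'a \<Rightarrow> 'a \<Rightarrow> real" and C :: "'a set"
  assumes "quasi_metric_on X d"
    and "C \<noteq> {}" and "C \<subseteq> X" and "qbounded d C"
  shows "(\<exists>S. codec_seq_for X C S \<and>
            (\<forall>t::real. 0 \<le> t \<and> ereal t < inverse (upper_dim_exp X d C) \<longrightarrow>
               (\<exists>K>0. \<forall>n\<ge>1. distortion d C (S n) \<le> ereal (K * real n powr (- t))) \<and>
               rate_class d C S t = C)) \<and>
         (\<forall>\<mu>::'a measure. prob_space \<mu> \<and> space \<mu> = X \<and> critical_measure X d C \<mu> \<longrightarrow>
            (\<forall>t::real. inverse (lower_dim_exp X d C) < ereal t \<longrightarrow>
               (\<exists>c>0. \<exists>\<epsilon>0>0. \<forall>n\<ge>1. \<forall>ED. codec_for X C n ED \<longrightarrow>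
                  (\<forall>\<epsilon>. 0 < \<epsilon> \<and> \<epsilon> < \<epsilon>0 \<longrightarrow>
                     outer_measure_of \<mu> {x\<in>C. d x (reconstruct ED x) \<le> \<epsilon>}
                       \<le> ennreal (2 powr (real n - c * \<epsilon> powr (- 1 / t)))))) \<and>
            (\<forall>S. codec_seq_for X C S \<longrightarrow>
               (\<forall>t::real. inverse (lower_dim_exp X d C) < ereal t \<longrightarrow>
                  outer_measure_of \<mu> (rate_class d C S t) = 0) \<and>
               outer_measure_of \<mu>
                 (\<Union>t\<in>{t::real. inverse (lower_dim_exp X d C) < ereal t}. rate_class d C S t) = 0))"
proof (intro conjI allI impI)
  obtain S where S: "codec_seq_for X C S"
    "\<And>t. 0 \<le> t \<Longrightarrow> ereal t < inverse (upper_dim_exp X d C) \<Longrightarrow>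
       \<exists>K>0. \<forall>n\<ge>1. distortion d C (S n) \<le> ereal (K * real n powr (- t))"
    using achievability[OF assms] by metis
  show "\<exists>S. codec_seq_for X C S \<and>
            (\<forall>t::real. 0 \<le> t \<and> ereal t < inverse (upper_dim_exp X d C) \<longrightarrow>
               (\<exists>K>0. \<forall>n\<ge>1. distortion d C (S n) \<le> ereal (K * real n powr (- t))) \<and>
               rate_class d C S t = C)"
    using S rate_class_eqI[of _ d C S] by metis
next
  fix \<mu> :: "'a measure" and t :: real
  assume "prob_space \<mu> \<and> space \<mu> = X \<and> critical_measure X d C \<mu>"
  then have \<mu>: "space \<mu> = X" "critical_measure X d C \<mu>" by auto
  assume "inverse (lower_dim_exp X d C) < ereal t"
  note codec_outer_measure_bound[OF assms(1,3) \<mu>(1)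
      critical_measure_small_ball(2)[OF assms(1,3) \<mu>(2) this]]
  then obtain c \<epsilon>0 where "c > 0" "\<epsilon>0 > 0"
    "\<forall>n ED. codec_for X C n ED \<longrightarrow>
      (\<forall>\<epsilon>. 0 < \<epsilon> \<and> \<epsilon> < \<epsilon>0 \<longrightarrow>
         outer_measure_of \<mu> {x\<in>C. d x (reconstruct ED x) \<le> \<epsilon>}
           \<le> ennreal (2 powr (real n - c * \<epsilon> powr (- (1 / t)))))"
    by (elim exE conjE)
  then show "\<exists>c>0. \<exists>\<epsilon>0>0. \<forall>n\<ge>1. \<forall>ED. codec_for X C n ED \<longrightarrow>
      (\<forall>\<epsilon>. 0 < \<epsilon> \<and> \<epsilon> < \<epsilon>0 \<longrightarrow>
         outer_measure_of \<mu> {x\<in>C. d x (reconstruct ED x) \<le> \<epsilon>}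
           \<le> ennreal (2 powr (real n - c * \<epsilon> powr (- 1 / t))))"
    by (intro exI[of _ c] conjI exI[of _ \<epsilon>0]) auto
next
  fix \<mu> :: "'a measure" and S :: "nat \<Rightarrow> 'a codec"
  assume "prob_space \<mu> \<and> space \<mu> = X \<and> critical_measure X d C \<mu>"
  then have \<mu>: "space \<mu> = X" "critical_measure X d C \<mu>" by auto
  assume S: "codec_seq_for X C S"
  show null: "outer_measure_of \<mu> (rate_class d C S t) = 0"
    if t: "inverse (lower_dim_exp X d C) < ereal t" for t
  proof -
    \<comment> \<open>An intermediate \<open>u\<close> provides the strict gap in exponents.\<close>
    obtain u where u: "inverse (lower_dim_exp X d C) < ereal u" "u < t"
      using ereal_dense2[OF t] by auto
    with critical_measure_small_ball[OF assms(1,3) \<mu>(2) u(1)] show ?thesis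
      using rate_class_outer_measure_0[OF assms(1,3) \<mu>(1) S] by blast
  qed
  define T where "T = {t::real. inverse (lower_dim_exp X d C) < ereal t}"
  \<comment> \<open>Below each \<open>t\<close> in \<open>T\<close> lies a rational that is still in
    \<open>T\<close>, and its rate class is at least as large.\<close>
  have sub: "(\<Union>t\<in>T. rate_class d C S t) \<subseteq> (\<Union>q\<in>T \<inter> \<rat>. rate_class d C S q)"
  proof (rule UN_least)
    fix t assume "t \<in> T"
    then obtain u where u: "inverse (lower_dim_exp X d C) < ereal u" "u < t"
      using ereal_dense2 unfolding T_def by force
    obtain q where q: "q \<in> \<rat>" "u < q" "q < t"
      using Rats_dense_in_real[OF u(2)] by blast
    have "q \<in> T"
      using u(1) q(2) by (auto simp: T_def intro: less_trans)
    then show "rate_class d C S t \<subseteq> (\<Union>q\<in>T \<inter> \<rat>. rate_class d C S q)"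
      using q rate_class_antimono[OF assms(1,3) S, of q t] by auto
  qed
  have "outer_measure_of \<mu> (\<Union>q\<in>T \<inter> \<rat>. rate_class d C S q) = 0"
  proof (rule outer_measure_of_UN_eq_0)
    show "countable (T \<inter> \<rat>)"
      by (rule countable_subset[OF _ countable_rat]) auto
    show "rate_class d C S q \<subseteq> space \<mu>" for q
      using assms(3) \<mu>(1) by (auto simp: rate_class_def)
    show "outer_measure_of \<mu> (rate_class d C S q) = 0" if "q \<in> T \<inter> \<rat>" for q
      using null that by (simp add: T_def)
  qed
  then show "outer_measure_of \<mu>
      (\<Union>t\<in>{t::real. inverse (lower_dim_exp X d C) < ereal t}. rate_class d C S t) = 0"
    using outer_measure_of_mono[OF sub, of \<mu>] by (simp add: T_def)
qed

end
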